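(* There exist universal constants $c_0,c_1,C>0$, $s\in(0,1)$ and $\psi\in(0,1)$ such that if $m>c_0n$ and $A\in\mathbb{R}^{m\times n}$ is a random matrix whose entries are i.i.d. standard Gaussians $N(0,1)$, then with probability at least $1-C\exp(-c_1m)$, $$\|(|Ax|-|Ay|)_T\|_1\le\psi\,\|(|Ax|-|Ay|)_{T^c}\|_1\quad\text{for all }x,y\in\mathbb{R}^n\text{ and all }T\subseteq[m]\text{ with }|T|\le sm.$$ Consequently, $A$ satisfies the $1$-Absolute Range Property (of order $sm$ for $\psi$) with high probability for $m$ sufficiently large.
   Context: For a vector $z\in\mathbb{R}^m$, $|z|$ denotes the vector of entrywise absolute values; $[m]=\{1,\dots,m\}$; for $T\subseteq[m]$, $z_T\in\mathbb{R}^m$ is the vector with $i$-th entry $z_i$ if $i\in T$ and $0$ otherwise; $T^c=[m]\setminus T$. For $p\in\{1,2\}$, a matrix $A\in\mathbb{R}^{m\times n}$ satisfies the $p$-Absolute Range Property of order $L$ for $\psi\in(0,1)$ if $\|(|Ax|^p-|Ay|^p)_T\|_1\le\psi\|(|Ax|^p-|Ay|^p)_{T^c}\|_1$ for all $x,y\in\mathbb{R}^n$ and all $T\subseteq[m]$ with $|T|\le L$ (powers taken entrywise). *)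

theory Defs
  imports "HOL-Probability.Probability" "Jordan_Normal_Form.Matrix"
begin

text \<open>The dimensions \<open>m\<close> and \<open>n\<close> are bound below the universal constants, so vectors and matrices
  are those of \<^theory>\<open>Jordan_Normal_Form.Matrix\<close>, with indices \<open>0, \<dots>, m - 1\<close>; the index set
  \<open>[m]\<close> is \<open>{..<m}\<close>.\<close>

no_notation Finite_Cartesian_Product.vec_nth (infixl "$" 90)
hide_type (open) Finite_Cartesian_Product.vec

definition abs_vec :: "real vec \<Rightarrow> real vec" where
  "abs_vec z = map_vec abs z"

definition l1_norm :: "real vec \<Rightarrow> real" where
  "l1_norm z = (\<Sum>i<dim_vec z. \<bar>z $ i\<bar>)"

definition restrict_vec :: "real vec \<Rightarrow> nat set \<Rightarrow> real vec" where
  "restrict_vec z T = vec (dim_vec z) (\<lambda>i. if i \<in> T then z $ i else 0)"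

definition pow_vec :: "real vec \<Rightarrow> nat \<Rightarrow> real vec" where
  "pow_vec z p = map_vec (\<lambda>t. t ^ p) z"

text \<open>The order \<open>L\<close> is a real number, since it is used with \<open>L = s * m\<close>.\<close>

definition absolute_range_property :: "nat \<Rightarrow> real \<Rightarrow> real \<Rightarrow> real mat \<Rightarrow> bool" where
  "absolute_range_property p L \<psi> A \<longleftrightarrow>
     p \<in> {1, 2} \<and> 0 < \<psi> \<and> \<psi> < 1 \<and>
     (\<forall>x \<in> carrier_vec (dim_col A). \<forall>y \<in> carrier_vec (dim_col A). \<forall>T \<subseteq> {..<dim_row A}.
        real (card T) \<le> L \<longrightarrow>
        l1_norm (restrict_vec (pow_vec (abs_vec (A *\<^sub>v x)) p - pow_vec (abs_vec (A *\<^sub>v y)) p) T)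
        \<le> \<psi> * l1_norm (restrict_vec (pow_vec (abs_vec (A *\<^sub>v x)) p - pow_vec (abs_vec (A *\<^sub>v y)) p)
                 ({..<dim_row A} - T)))"

text \<open>The law of an array \<open>\<omega>\<close> of i.i.d. standard Gaussians indexed by \<open>{..<m} \<times> {..<n}\<close>; the
  corresponding random matrix is \<open>mat m n \<omega>\<close>. Using one fixed sample space for each \<open>m\<close> and \<open>n\<close>,
  rather than an arbitrary \<open>'w measure\<close>, keeps universal constants independent of a sample type
  \<open>'w\<close>. This is no restriction:
  by \<open>gaussian_array_iid\<close> the entries are i.i.d. standard Gaussians, and by
  \<open>distr_eq_gaussian_array\<close> every such family, on any probability space, has this law.\<close>

definition gaussian_array :: "nat \<Rightarrow> nat \<Rightarrow> (nat \<times> nat \<Rightarrow> real) measure" where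
  "gaussian_array m n = Pi\<^sub>M ({..<m} \<times> {..<n}) (\<lambda>_. density lborel std_normal_density)"

lemma prob_space_gaussian_array: "prob_space (gaussian_array m n)"
  unfolding gaussian_array_def
  by (intro prob_space_PiM prob_space_normal_density) simp

lemma sets_gaussian_array:
  "sets (gaussian_array m n) = sets (Pi\<^sub>M ({..<m} \<times> {..<n}) (\<lambda>_. borel))"
  unfolding gaussian_array_def by (intro sets_PiM_cong) auto

lemma distr_gaussian_array_component:
  assumes "ij \<in> {..<m} \<times> {..<n}"
  shows "distr (gaussian_array m n) borel (\<lambda>\<omega>. \<omega> ij) = density lborel std_normal_density"
proof -
  have "distr (gaussian_array m n) borel (\<lambda>\<omega>. \<omega> ij)
        = distr (gaussian_array m n) (density lborel std_normal_density) (\<lambda>\<omega>. \<omega> ij)"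
    by (intro distr_cong) auto
  also have "\<dots> = density lborel std_normal_density"
    unfolding gaussian_array_def using assms
    by (intro distr_PiM_component prob_space_normal_density) auto
  finally show ?thesis .
qed

lemma measurable_gaussian_array_component:
  assumes "ij \<in> {..<m} \<times> {..<n}"
  shows "(\<lambda>\<omega>. \<omega> ij) \<in> gaussian_array m n \<rightarrow>\<^sub>M borel"
proof -
  have "(\<lambda>\<omega>. \<omega> ij) \<in> Pi\<^sub>M ({..<m} \<times> {..<n}) (\<lambda>_. borel :: real measure) \<rightarrow>\<^sub>M borel"
    using assms by (rule measurable_component_singleton)
  then show ?thesis
    using measurable_cong_sets[OF sets_gaussian_array refl] by blast
qed

lemma gaussian_array_iid:
  assumes "0 < m" "0 < n"
  shows "prob_space.indep_vars (gaussian_array m n) (\<lambda>_. borel)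
           (\<lambda>(i, j) \<omega>. mat m n \<omega> $$ (i, j)) ({..<m} \<times> {..<n})"
    and "i < m \<Longrightarrow> j < n \<Longrightarrow>
         distributed (gaussian_array m n) lborel (\<lambda>\<omega>. mat m n \<omega> $$ (i, j)) std_normal_density"
proof -
  interpret prob_space "gaussian_array m n" by (rule prob_space_gaussian_array)
  let ?I = "{..<m} \<times> {..<n}"
  have ne: "?I \<noteq> {}" using assms by auto
  have "distr (gaussian_array m n) (Pi\<^sub>M ?I (\<lambda>_. borel)) (\<lambda>\<omega>. \<lambda>ij\<in>?I. \<omega> ij)
        = distr (gaussian_array m n) (gaussian_array m n) (\<lambda>\<omega>. \<omega>)"
  proof (rule distr_cong)
    fix \<omega> assume "\<omega> \<in> space (gaussian_array m n)"
    then have "\<omega> \<in> extensional ?I"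
      by (auto simp: gaussian_array_def space_PiM PiE_def)
    then show "(\<lambda>ij\<in>?I. \<omega> ij) = \<omega>" by (rule extensional_restrict)
  qed (auto simp: sets_gaussian_array)
  also have "\<dots> = Pi\<^sub>M ?I (\<lambda>ij. distr (gaussian_array m n) borel (\<lambda>\<omega>. \<omega> ij))"
    unfolding distr_id
    by (subst gaussian_array_def, rule PiM_cong) (simp_all only: distr_gaussian_array_component)
  finally have "indep_vars (\<lambda>_. borel) (\<lambda>ij \<omega>. \<omega> ij) ?I"
    by (subst indep_vars_iff_distr_eq_PiM'[OF ne]) (auto intro: measurable_gaussian_array_component)
  then show "indep_vars (\<lambda>_. borel) (\<lambda>(i, j) \<omega>. mat m n \<omega> $$ (i, j)) ?I"
    by (rule indep_vars_cong[THEN iffD1, rotated -1]) auto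
  assume ij: "i < m" "j < n"
  then have "(i, j) \<in> ?I" by simp
  from distr_gaussian_array_component[OF this] measurable_gaussian_array_component[OF this]
  show "distributed (gaussian_array m n) lborel (\<lambda>\<omega>. mat m n \<omega> $$ (i, j)) std_normal_density"
    using ij by (auto simp: distributed_def cong: distr_cong)
qed

lemma (in prob_space) distr_eq_gaussian_array:
  assumes "0 < m" "0 < n"
    and indep: "indep_vars (\<lambda>_. borel) X ({..<m} \<times> {..<n})"
    and dist: "\<And>ij. ij \<in> {..<m} \<times> {..<n} \<Longrightarrow> distributed M lborel (X ij) std_normal_density"
  shows "distr M (Pi\<^sub>M ({..<m} \<times> {..<n}) (\<lambda>_. borel)) (\<lambda>\<omega>. \<lambda>ij\<in>{..<m} \<times> {..<n}. X ij \<omega>)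
         = gaussian_array m n"
proof -
  let ?I = "{..<m} \<times> {..<n}"
  have ne: "?I \<noteq> {}" using assms by auto
  have rv: "random_variable borel (X ij)" if "ij \<in> ?I" for ij
    using indep that by (auto simp: indep_vars_def)
  have "distr M borel (X ij) = density lborel std_normal_density" if "ij \<in> ?I" for ij
  proof -
    have "distr M borel (X ij) = distr M lborel (X ij)" by (intro distr_cong) auto
    with dist[OF that] show ?thesis by (simp add: distributed_def)
  qed
  then show ?thesis
    using indep_vars_iff_distr_eq_PiM'[where M' = "\<lambda>_. borel", OF ne rv, THEN iffD1, OF _ indep]
    unfolding gaussian_array_def by (auto cong: PiM_cong)
qed

end

theory Submission
  imports Defs "HOL-Real_Asymp.Real_Asymp"
begin

text \<open>Since \<open>||a| - |b|| = min |a - b| |a + b|\<close>, the claim compares the sums over \<open>T\<close> and its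
  complement of \<open>min |a\<^sub>i \<cdot> u| |a\<^sub>i \<cdot> v|\<close>, where \<open>u = x - y\<close>, \<open>v = x + y\<close> and, by symmetry,
  \<open>|u| \<le> |v|\<close>. Two events about single vectors suffice.

  Upper bound: \<open>\<Sum>i\<in>T. |a\<^sub>i \<cdot> u|\<close> is \<open>\<sigma>\<^sup>T A u\<close> for a sign vector \<open>\<sigma>\<close> supported on \<open>T\<close>, hence
  at most \<open>|A\<^sup>T \<sigma>| |u|\<close>; a chi-square tail bound and a union bound over the \<open>3\<^sup>m\<close> vectors
  \<open>\<sigma> \<in> {-1, 0, 1}\<^sup>m\<close> give \<open>|A\<^sup>T \<sigma>|\<^sup>2 \<le> 12 m |T|\<close> simultaneously for all \<open>T\<close>, without any net for \<open>u\<close>.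

  Lower bound: on a finite net, at most \<open>m / 8\<close> of the products \<open>a\<^sub>i \<cdot> w\<close> are smaller than \<open>2 \<delta>\<close>; by the
  upper bound, passing from the net to an arbitrary \<open>u\<close> spoils at most \<open>m / 8\<close> further rows. So at
  least half of the rows have both \<open>|a\<^sub>i \<cdot> u|\<close> and \<open>|a\<^sub>i \<cdot> v|\<close> at least \<open>\<delta> |u|\<close>, and removing a small
  \<open>T\<close> leaves a quarter of them.\<close>

subsection \<open>Linear combinations of Gaussian entries\<close>

text \<open>Zero coefficients are discarded first, since \<open>sum_indep_normal\<close> asks for
  positive standard deviations; \<open>pos\<close> keeps the remaining index set nonempty.\<close>

lemma (in prob_space) distributed_sum_scaled_std_normal:
  fixes c :: "'i \<Rightarrow> real"
  assumes "finite I" and indep: "indep_vars (\<lambda>_. borel) X I"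
    and X: "\<And>i. i \<in> I \<Longrightarrow> distributed M lborel (X i) std_normal_density"
    and pos: "0 < (\<Sum>i\<in>I. (c i)\<^sup>2)"
  shows "distributed M lborel (\<lambda>\<omega>. \<Sum>i\<in>I. c i * X i \<omega>)
           (normal_density 0 (sqrt (\<Sum>i\<in>I. (c i)\<^sup>2)))"
proof -
  define J where "J = {i \<in> I. c i \<noteq> 0}"
  have J: "finite J" "J \<subseteq> I" using \<open>finite I\<close> by (auto simp: J_def)
  have "J \<noteq> {}"
  proof
    assume "J = {}"
    then have "(\<Sum>i\<in>I. (c i)\<^sup>2) = 0" by (intro sum.neutral) (auto simp: J_def)
    with pos show False by simp
  qed
  have "distributed M lborel (\<lambda>\<omega>. \<Sum>i\<in>J. c i * X i \<omega>)
          (normal_density (\<Sum>i\<in>J. 0) (sqrt (\<Sum>i\<in>J. \<bar>c i\<bar>\<^sup>2)))"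
  proof (rule sum_indep_normal)
    show "indep_vars (\<lambda>_. borel) (\<lambda>i \<omega>. c i * X i \<omega>) J"
      by (rule indep_vars_compose2[OF indep_vars_subset[OF indep J(2)]]) simp
    fix i assume i: "i \<in> J"
    then show "0 < \<bar>c i\<bar>" by (simp add: J_def)
    have "i \<in> I" using i J by auto
    from normal_density_affine[OF X[OF this], of "c i" 0] i
    show "distributed M lborel (\<lambda>\<omega>. c i * X i \<omega>) (normal_density 0 \<bar>c i\<bar>)"
      by (simp add: J_def)
  qed (use J \<open>J \<noteq> {}\<close> in auto)
  moreover have "(\<Sum>i\<in>J. c i * X i \<omega>) = (\<Sum>i\<in>I. c i * X i \<omega>)" for \<omega>
    using \<open>finite I\<close> by (intro sum.mono_neutral_left) (auto simp: J_def)
  moreover have "(\<Sum>i\<in>J. \<bar>c i\<bar>\<^sup>2) = (\<Sum>i\<in>I. (c i)\<^sup>2)"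
    using \<open>finite I\<close> unfolding power2_abs by (intro sum.mono_neutral_left) (auto simp: J_def)
  ultimately show ?thesis by simp
qed

lemma (in prob_space) indep_vars_block_sums:
  fixes X :: "'i \<Rightarrow> 'a \<Rightarrow> real"
  assumes indep: "indep_vars (\<lambda>_. borel) X I"
    and K: "\<And>j. j \<in> L \<Longrightarrow> K j \<subseteq> I" "disjoint_family_on K L"
  shows "indep_vars (\<lambda>_. borel) (\<lambda>j \<omega>. \<Sum>i\<in>K j. c i * X i \<omega>) L"
proof -
  have "indep_vars (\<lambda>_. borel)
          (\<lambda>j \<omega>. (\<lambda>f. \<Sum>i\<in>K j. c i * f i) (restrict (\<lambda>i. X i \<omega>) (K j))) L"
    by (rule indep_vars_compose2[OF indep_vars_restrict[OF indep K]]) measurable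
  then show ?thesis
    by (rule indep_vars_cong[THEN iffD1, rotated -1]) (auto intro!: ext)
qed

text \<open>Multiplying the density by the exponential doubles the variance and leaves the factor
  sqrt 2. This is the moment generating function of a chi-square variable at 1/4.\<close>

lemma (in prob_space) nn_integral_exp_square_normal:
  assumes X: "distributed M lborel X (normal_density 0 \<sigma>)" and "0 < \<sigma>"
  shows "(\<integral>\<^sup>+\<omega>. ennreal (exp ((X \<omega>)\<^sup>2 / (4 * \<sigma>\<^sup>2))) \<partial>M) = ennreal (sqrt 2)"
proof -
  have "\<sigma> \<noteq> 0" using \<open>0 < \<sigma>\<close> by simp
  have eq: "normal_density 0 \<sigma> x * exp (x\<^sup>2 / (4 * \<sigma>\<^sup>2)) = sqrt 2 * normal_density 0 (sqrt 2 * \<sigma>) x" for x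
  proof -
    have "exp (- x\<^sup>2 / (2 * \<sigma>\<^sup>2)) * exp (x\<^sup>2 / (4 * \<sigma>\<^sup>2)) = exp (- x\<^sup>2 / (4 * \<sigma>\<^sup>2))"
      unfolding exp_add[symmetric] using \<open>0 < \<sigma>\<close> by (simp add: field_simps)
    then show ?thesis
      by (simp add: normal_density_def real_sqrt_mult power_mult_distrib frac_eq_eq \<open>\<sigma> \<noteq> 0\<close>)
  qed
  have "(\<integral>\<^sup>+\<omega>. ennreal (exp ((X \<omega>)\<^sup>2 / (4 * \<sigma>\<^sup>2))) \<partial>M)
      = (\<integral>\<^sup>+x. ennreal (normal_density 0 \<sigma> x) * ennreal (exp (x\<^sup>2 / (4 * \<sigma>\<^sup>2))) \<partial>lborel)"
    by (rule distributed_nn_integral[OF X, symmetric]) measurable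
  also have "\<dots> = (\<integral>\<^sup>+x. ennreal (sqrt 2) * ennreal (normal_density 0 (sqrt 2 * \<sigma>) x) \<partial>lborel)"
    by (intro nn_integral_cong) (simp add: eq flip: ennreal_mult')
  also have "\<dots> = ennreal (sqrt 2)"
    using \<open>0 < \<sigma>\<close> by (subst nn_integral_cmult)
      (auto simp: nn_integral_eq_integral normal_density_nonneg)
  finally show ?thesis .
qed

text \<open>The density is at most 1 because \<open>1 / 2 \<le> \<sigma>\<close> gives 2 pi
  \<sigma>^2 \<ge> 1, and the interval has length 2 t.\<close>

lemma (in prob_space) normal_small_ball:
  assumes X: "distributed M lborel X (normal_density 0 \<sigma>)" and "1 / 2 \<le> \<sigma>" "0 \<le> t"
  shows "prob (X -` {-t<..<t} \<inter> space M) \<le> 2 * t"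
proof -
  have le1: "normal_density 0 \<sigma> x \<le> 1" for x
  proof -
    have "1 = sqrt 1" by simp
    also have "\<dots> \<le> sqrt (2 * pi * \<sigma>\<^sup>2)"
    proof (rule real_sqrt_le_mono)
      have "(1::real) \<le> 2 * 2 * (1/2)\<^sup>2" by (simp add: power2_eq_square)
      also have "\<dots> \<le> 2 * pi * \<sigma>\<^sup>2"
        using pi_ge_two assms by (intro mult_mono power_mono) auto
      finally show "1 \<le> 2 * pi * \<sigma>\<^sup>2" .
    qed
    finally have "1 / sqrt (2 * pi * \<sigma>\<^sup>2) \<le> 1" by simp
    then show ?thesis
      unfolding normal_density_def by (intro mult_le_one) auto
  qed
  have "emeasure M (X -` {-t<..<t} \<inter> space M)
      = (\<integral>\<^sup>+x. ennreal (normal_density 0 \<sigma> x) * indicator {-t<..<t} x \<partial>lborel)"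
    by (rule distributed_emeasure[OF X]) auto
  also have "\<dots> \<le> (\<integral>\<^sup>+x. indicator {-t<..<t} x \<partial>lborel)"
    using le1 by (intro nn_integral_mono) (auto split: split_indicator simp: ennreal_le_1)
  also have "\<dots> = ennreal (2 * t)"
    using \<open>0 \<le> t\<close> by simp
  finally show ?thesis
    using \<open>0 \<le> t\<close> by (simp add: emeasure_eq_measure)
qed

section \<open>Rows and columns of the Gaussian array\<close>

lemma indep_vars_gaussian_array:
  "prob_space.indep_vars (gaussian_array m n) (\<lambda>_. borel) (\<lambda>ij \<omega>. \<omega> ij) ({..<m} \<times> {..<n})"
proof -
  interpret prob_space "gaussian_array m n" by (rule prob_space_gaussian_array)
  show ?thesis
  proof (cases "0 < m \<and> 0 < n")
    case True
    then have "indep_vars (\<lambda>_. borel) (\<lambda>(i, j) \<omega>. mat m n \<omega> $$ (i, j)) ({..<m} \<times> {..<n})"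
      using gaussian_array_iid(1) by blast
    then show ?thesis by (rule indep_vars_cong[THEN iffD1, rotated -1]) auto
  next
    \<comment> \<open>If \<open>m\<close> or \<open>n\<close> is zero, the index set is empty and
      independence is vacuous.\<close>
    case False
    then show ?thesis by (auto simp: indep_vars_def indep_sets_def)
  qed
qed

lemma distributed_gaussian_array:
  assumes "ij \<in> {..<m} \<times> {..<n}"
  shows "distributed (gaussian_array m n) lborel (\<lambda>\<omega>. \<omega> ij) std_normal_density"
  using distr_gaussian_array_component[OF assms] measurable_gaussian_array_component[OF assms]
  by (auto simp: distributed_def cong: distr_cong)

text \<open>The injection \<open>g\<close> lets one statement cover both a column,
  \<open>i \<mapsto> (i, j)\<close>, and a row, \<open>j \<mapsto> (i, j)\<close>.\<close>

lemma distributed_block_gaussian_array: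
  fixes c :: "'i \<Rightarrow> real"
  assumes "finite I" "inj_on g I" "g ` I \<subseteq> {..<m} \<times> {..<n}" "0 < (\<Sum>i\<in>I. (c i)\<^sup>2)"
  shows "distributed (gaussian_array m n) lborel (\<lambda>\<omega>. \<Sum>i\<in>I. c i * \<omega> (g i))
           (normal_density 0 (sqrt (\<Sum>i\<in>I. (c i)\<^sup>2)))"
proof -
  interpret prob_space "gaussian_array m n" by (rule prob_space_gaussian_array)
  have *: "(\<Sum>x\<in>g ` I. (c (inv_into I g x))\<^sup>2) = (\<Sum>i\<in>I. (c i)\<^sup>2)"
    "(\<Sum>x\<in>g ` I. c (inv_into I g x) * \<omega> x) = (\<Sum>i\<in>I. c i * \<omega> (g i))" for \<omega> :: "_ \<Rightarrow> real"
    using assms by (simp_all add: sum.reindex)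
  have "distributed (gaussian_array m n) lborel (\<lambda>\<omega>. \<Sum>x\<in>g ` I. c (inv_into I g x) * \<omega> x)
          (normal_density 0 (sqrt (\<Sum>x\<in>g ` I. (c (inv_into I g x))\<^sup>2)))"
    using assms
    by (intro distributed_sum_scaled_std_normal indep_vars_subset[OF indep_vars_gaussian_array]
         distributed_gaussian_array) (auto simp: *)
  then show ?thesis unfolding * .
qed

lemma indep_vars_columns:
  "prob_space.indep_vars (gaussian_array m n) (\<lambda>_. borel)
     (\<lambda>j \<omega>. \<Sum>i<m. \<sigma> i * \<omega> (i, j)) {..<n}"
proof -
  interpret prob_space "gaussian_array m n" by (rule prob_space_gaussian_array)
  have "indep_vars (\<lambda>_. borel) (\<lambda>j \<omega>. \<Sum>x\<in>(\<lambda>i. (i, j)) ` {..<m}. \<sigma> (fst x) * \<omega> x) {..<n}"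
    by (rule indep_vars_block_sums[OF indep_vars_gaussian_array]) (auto simp: disjoint_family_on_def)
  then show ?thesis by (simp add: sum.reindex inj_on_def)
qed

lemma indep_vars_rows:
  "prob_space.indep_vars (gaussian_array m n) (\<lambda>_. borel)
     (\<lambda>i \<omega>. \<Sum>j<n. w j * \<omega> (i, j)) {..<m}"
proof -
  interpret prob_space "gaussian_array m n" by (rule prob_space_gaussian_array)
  have "indep_vars (\<lambda>_. borel) (\<lambda>i \<omega>. \<Sum>x\<in>(\<lambda>j. (i, j)) ` {..<n}. w (snd x) * \<omega> x) {..<m}"
    by (rule indep_vars_block_sums[OF indep_vars_gaussian_array]) (auto simp: disjoint_family_on_def)
  then show ?thesis by (simp add: sum.reindex inj_on_def)
qed

lemma measurable_gaussian_array_entry [measurable]: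
  "i < m \<Longrightarrow> j < n \<Longrightarrow> (\<lambda>\<omega>. \<omega> (i, j)) \<in> borel_measurable (gaussian_array m n)"
  by (rule measurable_gaussian_array_component) simp

section \<open>Tail bound for one sign vector, small-ball bound for one direction\<close>

text \<open>The coordinates of A^T \<sigma> are independent N(0, v), so the exponential of |A^T
  \<sigma>|^2 / (4 v) has mean (sqrt 2)^n, and Markov's inequality applies.\<close>

lemma column_norm_tail:
  assumes v: "v = (\<Sum>i<m. (\<sigma> i)\<^sup>2)" "0 < v"
  shows "measure (gaussian_array m n)
           {\<omega> \<in> space (gaussian_array m n). K * v \<le> (\<Sum>j<n. (\<Sum>i<m. \<sigma> i * \<omega> (i, j))\<^sup>2)}
         \<le> exp (- K / 4) * sqrt 2 ^ n"
proof -
  interpret prob_space "gaussian_array m n" by (rule prob_space_gaussian_array)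
  let ?M = "gaussian_array m n"
  let ?Y = "\<lambda>j \<omega>. \<Sum>i<m. \<sigma> i * \<omega> (i, j)"
  let ?u = "\<lambda>\<omega>. \<Prod>j<n. ennreal (exp ((?Y j \<omega>)\<^sup>2 / (4 * v)))"
  have I: "(\<integral>\<^sup>+\<omega>. ?u \<omega> \<partial>?M) = ennreal (sqrt 2 ^ n)"
  proof -
    have "indep_vars (\<lambda>_. borel) (\<lambda>j \<omega>. ennreal (exp ((?Y j \<omega>)\<^sup>2 / (4 * v)))) {..<n}"
      by (rule indep_vars_compose2[OF indep_vars_columns]) measurable
    then have "(\<integral>\<^sup>+\<omega>. ?u \<omega> \<partial>?M)
             = (\<Prod>j<n. \<integral>\<^sup>+\<omega>. ennreal (exp ((?Y j \<omega>)\<^sup>2 / (4 * v))) \<partial>?M)"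
      by (intro indep_vars_nn_integral) auto
    also have "\<dots> = (\<Prod>j<n. ennreal (sqrt 2))"
    proof (rule prod.cong[OF refl])
      fix j assume "j \<in> {..<n}"
      then have "distributed ?M lborel (?Y j) (normal_density 0 (sqrt v))"
        unfolding v(1) using v by (intro distributed_block_gaussian_array) (auto simp: inj_on_def)
      from nn_integral_exp_square_normal[OF this] v(2)
      show "(\<integral>\<^sup>+\<omega>. ennreal (exp ((?Y j \<omega>)\<^sup>2 / (4 * v))) \<partial>?M) = ennreal (sqrt 2)"
        by simp
    qed
    also have "\<dots> = ennreal (sqrt 2 ^ n)"
      by (simp add: ennreal_power)
    finally show ?thesis .
  qed
  have u: "?u \<omega> = ennreal (exp ((\<Sum>j<n. (?Y j \<omega>)\<^sup>2) / (4 * v)))" for \<omega>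
    by (simp add: prod_ennreal sum_divide_distrib exp_sum)
  have "emeasure ?M {\<omega> \<in> space ?M. K * v \<le> (\<Sum>j<n. (?Y j \<omega>)\<^sup>2)}
      \<le> emeasure ?M {\<omega> \<in> space ?M. 1 \<le> ennreal (exp (- K / 4)) * ?u \<omega>}"
  proof (rule emeasure_mono)
    show "{\<omega> \<in> space ?M. K * v \<le> (\<Sum>j<n. (?Y j \<omega>)\<^sup>2)}
        \<subseteq> {\<omega> \<in> space ?M. 1 \<le> ennreal (exp (- K / 4)) * ?u \<omega>}"
    proof safe
      fix \<omega> assume "K * v \<le> (\<Sum>j<n. (?Y j \<omega>)\<^sup>2)"
      then have "0 \<le> - K / 4 + (\<Sum>j<n. (?Y j \<omega>)\<^sup>2) / (4 * v)"
        using v(2) by (simp add: field_simps)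
      then have "1 \<le> exp (- K / 4) * exp ((\<Sum>j<n. (?Y j \<omega>)\<^sup>2) / (4 * v))"
        unfolding exp_add[symmetric] by simp
      then show "1 \<le> ennreal (exp (- K / 4)) * ?u \<omega>"
        unfolding u by (simp flip: ennreal_mult)
    qed
  qed measurable
  also have "\<dots> \<le> ennreal (exp (- K / 4)) * (\<integral>\<^sup>+\<omega>. ?u \<omega> * indicator (space ?M) \<omega> \<partial>?M)"
    by (rule nn_integral_Markov_inequality) measurable
  also have "(\<integral>\<^sup>+\<omega>. ?u \<omega> * indicator (space ?M) \<omega> \<partial>?M) = (\<integral>\<^sup>+\<omega>. ?u \<omega> \<partial>?M)"
    by (intro nn_integral_cong) simp
  also have "ennreal (exp (- K / 4)) * \<dots> = ennreal (exp (- K / 4) * sqrt 2 ^ n)"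
    unfolding I by (simp add: ennreal_mult')
  finally show ?thesis
    by (simp add: emeasure_eq_measure)
qed

text \<open>The products of distinct rows with \<open>w\<close> are independent normal variables of
  standard deviation |w|, so the one-dimensional small-ball bounds multiply.\<close>

lemma rows_small_ball:
  assumes w: "1 / 2 \<le> L2_set w {..<n}" and "T \<subseteq> {..<m}" "0 \<le> t"
  shows "measure (gaussian_array m n)
           {\<omega> \<in> space (gaussian_array m n). \<forall>i\<in>T. \<bar>\<Sum>j<n. w j * \<omega> (i, j)\<bar> < t}
         \<le> (2 * t) ^ card T"
proof (cases "T = {}")
  case True
  then show ?thesis
    using prob_space.prob_le_1[OF prob_space_gaussian_array] by simp
next
  case False
  interpret prob_space "gaussian_array m n" by (rule prob_space_gaussian_array)
  let ?M = "gaussian_array m n"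
  let ?Y = "\<lambda>i \<omega>. \<Sum>j<n. w j * \<omega> (i, j)"
  have "finite T" using assms finite_subset by blast
  have "{\<omega> \<in> space ?M. \<forall>i\<in>T. \<bar>?Y i \<omega>\<bar> < t} = (\<Inter>i\<in>T. ?Y i -` {-t<..<t} \<inter> space ?M)"
    using False by (auto simp: abs_less_iff minus_less_iff)
  also have "prob \<dots> = (\<Prod>i\<in>T. prob (?Y i -` {-t<..<t} \<inter> space ?M))"
    using False \<open>finite T\<close> assms by (intro indep_varsD[OF indep_vars_rows]) auto
  also have "\<dots> \<le> (\<Prod>i\<in>T. 2 * t)"
  proof (rule prod_mono, intro conjI)
    fix i assume "i \<in> T"
    have "0 < L2_set w {..<n}" using w by linarith
    then have "0 < (\<Sum>j<n. (w j)\<^sup>2)" by (simp only: L2_set_def real_sqrt_gt_0_iff)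
    then have "distributed ?M lborel (?Y i) (normal_density 0 (L2_set w {..<n}))"
      unfolding L2_set_def using \<open>i \<in> T\<close> assms
      by (intro distributed_block_gaussian_array) (auto simp: inj_on_def)
    from normal_small_ball[OF this w \<open>0 \<le> t\<close>]
    show "prob (?Y i -` {-t<..<t} \<inter> space ?M) \<le> 2 * t" .
  qed simp
  finally show ?thesis by simp
qed

subsection \<open>Union bounds over sign vectors and over a net\<close>

text \<open>For entries in {-1, 0, 1} the sum of squares is the size of the support, so the bound
  reads |A^T \<sigma>|^2 \<le> 12 m |supp \<sigma>|. Extensional functions make the family of
  \<sigma> finite.\<close>

definition rows_bounded :: "nat \<Rightarrow> nat \<Rightarrow> (nat \<times> nat \<Rightarrow> real) \<Rightarrow> bool" where
  "rows_bounded m n \<omega> \<longleftrightarrow> (\<forall>\<sigma>\<in>{..<m} \<rightarrow>\<^sub>E {-1, 0, 1}.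
     (\<Sum>j<n. (\<Sum>i<m. \<sigma> i * \<omega> (i, j))\<^sup>2) \<le> 12 * real m * (\<Sum>i<m. (\<sigma> i)\<^sup>2))"

lemma sets_rows_bounded: "{\<omega> \<in> space (gaussian_array m n). rows_bounded m n \<omega>} \<in> sets (gaussian_array m n)"
proof -
  have [measurable]: "finite ({..<m} \<rightarrow>\<^sub>E {-1, 0, 1 :: real})" by (intro finite_PiE) auto
  show ?thesis unfolding rows_bounded_def by measurable
qed

lemma prob_not_rows_bounded:
  assumes "n \<le> m"
  shows "measure (gaussian_array m n) {\<omega> \<in> space (gaussian_array m n). \<not> rows_bounded m n \<omega>}
         \<le> exp (- real m)"
proof -
  interpret prob_space "gaussian_array m n" by (rule prob_space_gaussian_array)
  let ?M = "gaussian_array m n"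
  let ?S = "{..<m} \<rightarrow>\<^sub>E {-1, 0, 1 :: real}"
  let ?F = "\<lambda>\<sigma>. {\<omega> \<in> space ?M.
    12 * real m * (\<Sum>i<m. (\<sigma> i)\<^sup>2) < (\<Sum>j<n. (\<Sum>i<m. \<sigma> i * \<omega> (i, j))\<^sup>2)}"
  have "finite ?S" by (intro finite_PiE) auto
  have card_S: "card ?S = 3 ^ m" by (subst card_PiE) (auto simp: numeral_3_eq_3)
  have sets: "?F \<sigma> \<in> sets ?M" for \<sigma> by measurable
  have F: "prob (?F \<sigma>) \<le> exp (- 3 * real m) * sqrt 2 ^ m" for \<sigma>
  \<comment> \<open>\<open>column_norm_tail\<close> needs a positive sum of squares; for \<sigma>
    vanishing on \<open>{..<m}\<close> the strict inequality in \<open>?F \<sigma>\<close> reads 0 <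
    0.\<close>
  proof (cases "(\<Sum>i<m. (\<sigma> i)\<^sup>2) = 0")
    case True
    then have "\<sigma> i = 0" if "i < m" for i
      using that by (subst (asm) sum_nonneg_eq_0_iff) auto
    then have empty: "?F \<sigma> = {}" by auto
    show ?thesis unfolding empty by simp
  next
    case False
    then have pos: "0 < (\<Sum>i<m. (\<sigma> i)\<^sup>2)"
      using sum_nonneg[of "{..<m}" "\<lambda>i. (\<sigma> i)\<^sup>2"] by simp
    have "prob (?F \<sigma>) \<le> prob {\<omega> \<in> space ?M.
      12 * real m * (\<Sum>i<m. (\<sigma> i)\<^sup>2) \<le> (\<Sum>j<n. (\<Sum>i<m. \<sigma> i * \<omega> (i, j))\<^sup>2)}"
      by (rule finite_measure_mono) (auto, measurable)
    also have "\<dots> \<le> exp (- (12 * real m) / 4) * sqrt 2 ^ n"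
      by (rule column_norm_tail[OF refl pos])
    also have "\<dots> \<le> exp (- 3 * real m) * sqrt 2 ^ m"
      using assms by (intro mult_mono power_increasing) auto
    finally show ?thesis .
  qed
  have "prob {\<omega> \<in> space ?M. \<not> rows_bounded m n \<omega>} = prob (\<Union>\<sigma>\<in>?S. ?F \<sigma>)"
    by (rule arg_cong[where f = prob]) (auto simp: rows_bounded_def not_le)
  also have "\<dots> \<le> (\<Sum>\<sigma>\<in>?S. prob (?F \<sigma>))"
    by (intro finite_measure_subadditive_finite \<open>finite ?S\<close> image_subsetI sets)
  also have "\<dots> \<le> (\<Sum>\<sigma>\<in>?S. exp (- 3 * real m) * sqrt 2 ^ m)"
    by (intro sum_mono F)
  also have "\<dots> = (3 * sqrt 2) ^ m * exp (- 3 * real m)"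
    by (simp add: card_S power_mult_distrib)
  \<comment> \<open>Since 3 sqrt 2 \<le> 9/2 < 5 \<le> e^2, the 3^m sign vectors and the factor
    (sqrt 2)^m use up only e^(2m) of the decay e^(-3m) that the constant 12 provides.\<close>
  also have "\<dots> \<le> exp 2 ^ m * exp (- 3 * real m)"
  proof (intro mult_right_mono power_mono)
    have "sqrt 2 \<le> 3 / 2" by (rule real_le_lsqrt) (auto simp: power2_eq_square)
    moreover have "5 \<le> exp (2::real)" using exp_lower_Taylor_quadratic[of 2] by simp
    ultimately show "3 * sqrt 2 \<le> exp 2" by linarith
  qed auto
  also have "\<dots> = exp (- real m)"
    by (simp flip: exp_of_nat_mult exp_add)
  finally show ?thesis .
qed

text \<open>With \<open>2 t = e\<^bsup>-24\<^esup>\<close>, the bound \<open>(2 t)\<^bsup>m/8\<^esup> = e\<^bsup>-3m\<^esup>\<close> absorbs the \<open>2\<^sup>m\<close> choices of a row set.\<close>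

lemma many_small_rows:
  assumes "1 / 2 \<le> L2_set w {..<n}" and t: "2 * t = exp (- 24)"
  shows "measure (gaussian_array m n)
           {\<omega> \<in> space (gaussian_array m n).
              real m / 8 < real (card {i\<in>{..<m}. \<bar>\<Sum>j<n. w j * \<omega> (i, j)\<bar> < t})}
         \<le> exp (- 2 * real m)"
proof -
  interpret prob_space "gaussian_array m n" by (rule prob_space_gaussian_array)
  let ?M = "gaussian_array m n"
  let ?S = "{T. T \<subseteq> {..<m} \<and> real m / 8 < real (card T)}"
  let ?F = "\<lambda>T. {\<omega> \<in> space ?M. \<forall>i\<in>T. \<bar>\<Sum>j<n. w j * \<omega> (i, j)\<bar> < t}"
  have "0 \<le> t" using t exp_ge_zero[of "-24 :: real"] by linarith
  have "finite ?S" by (rule finite_subset[of _ "Pow {..<m}"]) auto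
  have "card ?S \<le> card (Pow {..<m})" by (rule card_mono) auto
  then have "card ?S \<le> 2 ^ m" by (simp only: card_Pow finite_lessThan card_lessThan)
  then have "real (card ?S) \<le> real (2 ^ m)" by (rule of_nat_mono)
  then have card_S: "real (card ?S) \<le> 2 ^ m" by simp
  have sets: "?F T \<in> sets ?M" if "T \<in> ?S" for T
  proof -
    have [measurable]: "finite T" "\<And>i. i \<in> T \<Longrightarrow> i < m" using that finite_subset by auto
    show ?thesis by measurable
  qed
  have F: "prob (?F T) \<le> exp (- 3 * real m)" if "T \<in> ?S" for T
  proof -
    have "prob (?F T) \<le> exp (- 24) ^ card T"
      unfolding t[symmetric] using that assms(1) \<open>0 \<le> t\<close> by (intro rows_small_ball) auto
    also have "\<dots> = exp (- 24 * real (card T))" by (simp flip: exp_of_nat_mult)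
    also have "\<dots> \<le> exp (- 3 * real m)" using that by simp
    finally show ?thesis .
  qed
  have "prob {\<omega> \<in> space ?M.
      real m / 8 < real (card {i\<in>{..<m}. \<bar>\<Sum>j<n. w j * \<omega> (i, j)\<bar> < t})} \<le> prob (\<Union>T\<in>?S. ?F T)"
  proof (rule finite_measure_mono)
    show "{\<omega> \<in> space ?M. real m / 8 < real (card {i\<in>{..<m}. \<bar>\<Sum>j<n. w j * \<omega> (i, j)\<bar> < t})}
        \<subseteq> (\<Union>T\<in>?S. ?F T)"
    proof
      fix \<omega> assume "\<omega> \<in> {\<omega> \<in> space ?M.
        real m / 8 < real (card {i\<in>{..<m}. \<bar>\<Sum>j<n. w j * \<omega> (i, j)\<bar> < t})}"
      then show "\<omega> \<in> (\<Union>T\<in>?S. ?F T)"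
        by (intro UN_I[of "{i\<in>{..<m}. \<bar>\<Sum>j<n. w j * \<omega> (i, j)\<bar> < t}"] CollectI conjI) auto
    qed
    show "(\<Union>T\<in>?S. ?F T) \<in> events"
      by (intro sets.finite_UN \<open>finite ?S\<close> sets)
  qed
  also have "\<dots> \<le> (\<Sum>T\<in>?S. prob (?F T))"
    by (intro finite_measure_subadditive_finite \<open>finite ?S\<close> image_subsetI sets)
  also have "\<dots> \<le> (\<Sum>T\<in>?S. exp (- 3 * real m))"
    by (intro sum_mono F)
  also have "\<dots> = real (card ?S) * exp (- 3 * real m)" by simp
  also have "\<dots> \<le> exp 1 ^ m * exp (- 3 * real m)"
    using exp_ge_add_one_self[of 1]
    by (intro mult_right_mono order.trans[OF card_S] power_mono) auto
  also have "\<dots> = exp (- 2 * real m)"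
    by (simp flip: exp_of_nat_mult exp_add)
  finally show ?thesis .
qed

text \<open>Truncating the coordinates of a unit vector to multiples of \<open>1 / (q \<surd>n)\<close> gives an
  approximation in this set of integer points of small \<open>l\<^sup>1\<close>-norm; it replaces the
  usual volumetric net.\<close>

definition grid_net :: "nat \<Rightarrow> nat \<Rightarrow> (nat \<Rightarrow> real) set" where
  "grid_net q n = (\<lambda>z j. of_int (z j) / (real q * sqrt (real n))) `
     {z \<in> {..<n} \<rightarrow>\<^sub>E (UNIV :: int set). (\<Sum>j<n. \<bar>z j\<bar>) \<le> int ((q + 1) * n)}"

text \<open>A truncated two-sided geometric series with limit 3; the subtracted tail makes the
  induction close.\<close>

lemma sum_half_power_abs_le: "(\<Sum>k\<in>{- int B..int B}. (1 / 2 :: real) ^ nat \<bar>k\<bar>) \<le> 3 - 2 * (1 / 2) ^ B"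
proof (induction B)
  case (Suc B)
  have "{- int (Suc B)..int (Suc B)} = insert (- int (Suc B)) (insert (int (Suc B)) {- int B..int B})"
    by auto
  with Suc show ?case by (simp add: nat_add_distrib)
qed simp

text \<open>The count is an exponential Markov bound with the product weight \<open>2\<close> to the power \<open>- |z|\<^sub>1\<close>.\<close>

lemma integer_l1_ball:
  fixes n R :: nat
  defines "Z \<equiv> {z \<in> {..<n} \<rightarrow>\<^sub>E (UNIV :: int set). (\<Sum>j<n. \<bar>z j\<bar>) \<le> int (R * n)}"
  shows "finite Z" and "real (card Z) \<le> (3 * 2 ^ R) ^ n"
proof -
  let ?B = "{- int (R * n)..int (R * n)}"
  let ?P = "{..<n} \<rightarrow>\<^sub>E ?B"
  have ZP: "Z \<subseteq> ?P"
  proof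
    fix z assume z: "z \<in> Z"
    have "\<bar>z j\<bar> \<le> int (R * n)" if "j < n" for j
    proof -
      have "\<bar>z j\<bar> \<le> (\<Sum>j<n. \<bar>z j\<bar>)" using that by (intro member_le_sum) auto
      then show ?thesis using z by (simp add: Z_def)
    qed
    then show "z \<in> ?P" using z by (auto simp: Z_def PiE_iff abs_le_iff minus_le_iff)
  qed
  have "finite ?P" by (intro finite_PiE) auto
  with ZP show "finite Z" by (rule finite_subset)
  have "real (card Z) = (\<Sum>z\<in>Z. 1)" by simp
  \<comment> \<open>Every point of \<open>Z\<close> has weight at least 2^(-R n).\<close>
  also have "\<dots> \<le> (\<Sum>z\<in>Z. 2 ^ (R * n) * (\<Prod>j<n. (1 / 2) ^ nat \<bar>z j\<bar>))"
  proof (rule sum_mono)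
    fix z assume "z \<in> Z"
    then have "(\<Sum>j<n. \<bar>z j\<bar>) \<le> int (R * n)" by (simp add: Z_def)
    then have "(\<Sum>j<n. nat \<bar>z j\<bar>) \<le> R * n"
      by (simp add: nat_le_iff flip: of_nat_le_iff[where 'a = int])
    then have "(1 / 2 :: real) ^ (R * n) \<le> (1 / 2) ^ (\<Sum>j<n. nat \<bar>z j\<bar>)"
      by (intro power_decreasing) auto
    then show "1 \<le> 2 ^ (R * n) * (\<Prod>j<n. (1 / 2 :: real) ^ nat \<bar>z j\<bar>)"
      unfolding power_sum[symmetric] by (simp add: field_simps)
  qed
  \<comment> \<open>Enlarging \<open>Z\<close> to the box \<open>?P\<close> adds only nonnegative
    terms and lets the sum factor over the coordinates.\<close>
  also have "\<dots> \<le> (\<Sum>z\<in>?P. 2 ^ (R * n) * (\<Prod>j<n. (1 / 2) ^ nat \<bar>z j\<bar>))"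
    using \<open>finite ?P\<close> ZP by (intro sum_mono2) (auto intro!: mult_nonneg_nonneg prod_nonneg)
  also have "\<dots> = 2 ^ (R * n) * (\<Prod>j<n. \<Sum>k\<in>?B. (1 / 2) ^ nat \<bar>k\<bar>)"
    by (subst prod_sum_PiE) (auto simp: sum_distrib_left)
  also have "\<dots> \<le> 2 ^ (R * n) * (\<Prod>j<n. 3)"
    using order.trans[OF sum_half_power_abs_le[of "R * n"]]
    by (intro mult_left_mono prod_mono) (auto intro!: sum_nonneg)
  also have "\<dots> = (3 * 2 ^ R) ^ n" by (simp add: power_mult power_mult_distrib)
  finally show "real (card Z) \<le> (3 * 2 ^ R) ^ n" .
qed

lemma finite_grid_net: "finite (grid_net q n)"
  unfolding grid_net_def by (intro finite_imageI integer_l1_ball)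

lemma card_grid_net: "real (card (grid_net q n)) \<le> (3 * 2 ^ (q + 1)) ^ n"
  unfolding grid_net_def
  by (rule order.trans[OF _ integer_l1_ball(2)])
     (intro of_nat_mono card_image_le integer_l1_ball(1))

text \<open>Each coordinate is rounded down to a multiple of 1 / r with r = q sqrt n, so the
  Euclidean error is at most sqrt n / r = 1 / q.\<close>

lemma grid_net_approx:
  assumes u: "L2_set u {..<n} = 1" and "0 < q"
  obtains w where "w \<in> grid_net q n" "L2_set (\<lambda>j. u j - w j) {..<n} \<le> 1 / real q"
proof -
  have "n \<noteq> 0" using u by (intro notI) simp
  define r where "r = real q * sqrt (real n)"
  have "0 < r" using \<open>n \<noteq> 0\<close> \<open>0 < q\<close> by (simp add: r_def)
  define z where "z = (\<lambda>j\<in>{..<n}. \<lfloor>u j * r\<rfloor>)"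
  define w where "w = (\<lambda>j. of_int (z j) / r)"
  \<comment> \<open>Cauchy-Schwarz. Scaling by \<open>r\<close> turns this into q n, and rounding
    adds at most 1 per coordinate, whence the radius (q + 1) n in \<open>grid_net\<close>.\<close>
  have l1: "(\<Sum>j<n. \<bar>u j\<bar>) \<le> sqrt (real n)"
  proof -
    have "(\<Sum>j<n. \<bar>u j\<bar>) = (\<Sum>j<n. \<bar>u j\<bar> * \<bar>1\<bar>)" by simp
    also have "\<dots> \<le> L2_set u {..<n} * L2_set (\<lambda>_. 1) {..<n}" by (rule L2_set_mult_ineq)
    also have "\<dots> = sqrt (real n)" unfolding u by (simp add: L2_set_def)
    finally show ?thesis .
  qed
  have "real_of_int (\<Sum>j<n. \<bar>z j\<bar>) = (\<Sum>j<n. \<bar>real_of_int \<lfloor>u j * r\<rfloor>\<bar>)"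
    by (simp add: z_def)
  also have "\<dots> \<le> (\<Sum>j<n. \<bar>u j\<bar> * r + 1)"
  proof (rule sum_mono)
    fix j
    have "\<bar>u j * r\<bar> = \<bar>u j\<bar> * r" using \<open>0 < r\<close> by (simp add: abs_mult)
    then show "\<bar>real_of_int \<lfloor>u j * r\<rfloor>\<bar> \<le> \<bar>u j\<bar> * r + 1"
      using floor_correct[of "u j * r"] by linarith
  qed
  also have "\<dots> = (\<Sum>j<n. \<bar>u j\<bar>) * r + real n"
    by (simp add: sum.distrib sum_distrib_right)
  also have "\<dots> \<le> sqrt (real n) * r + real n"
    using l1 \<open>0 < r\<close> by simp
  also have "\<dots> = real ((q + 1) * n)"
    by (simp add: r_def algebra_simps)
  finally have "(\<Sum>j<n. \<bar>z j\<bar>) \<le> int ((q + 1) * n)" by linarith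
  then have "w \<in> grid_net q n"
    unfolding grid_net_def w_def r_def by (intro image_eqI[where x = z]) (auto simp: z_def)
  moreover have "L2_set (\<lambda>j. u j - w j) {..<n} \<le> 1 / real q"
  proof -
    have "(\<Sum>j<n. (u j - w j)\<^sup>2) \<le> (\<Sum>j<n. (1 / r)\<^sup>2)"
    proof (rule sum_mono)
      fix j assume "j \<in> {..<n}"
      then have "u j - w j = (u j * r - of_int \<lfloor>u j * r\<rfloor>) / r"
        using \<open>0 < r\<close> by (simp add: w_def z_def field_simps)
      moreover have "0 \<le> u j * r - of_int \<lfloor>u j * r\<rfloor>" "u j * r - of_int \<lfloor>u j * r\<rfloor> \<le> 1"
        using floor_correct[of "u j * r"] by linarith+
      ultimately show "(u j - w j)\<^sup>2 \<le> (1 / r)\<^sup>2"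
        using \<open>0 < r\<close> by (intro power_mono) (auto intro: divide_right_mono)
    qed
    also have "\<dots> = (1 / real q)\<^sup>2"
      using \<open>n \<noteq> 0\<close> by (simp add: r_def power_divide power_mult_distrib)
    finally show ?thesis
      unfolding L2_set_def by (intro real_le_lsqrt) auto
  qed
  ultimately show ?thesis by (rule that)
qed

text \<open>Net points near the origin are left out because \<open>many_small_rows\<close> asks for
  norm at least 1/2. The threshold 2 \<delta> leaves room for a loss of \<delta> in passing to a
  nearby vector.\<close>

definition net_spread :: "nat \<Rightarrow> nat \<Rightarrow> nat \<Rightarrow> real \<Rightarrow> (nat \<times> nat \<Rightarrow> real) \<Rightarrow> bool" where
  "net_spread q m n \<delta> \<omega> \<longleftrightarrow> (\<forall>w\<in>grid_net q n. 1 / 2 \<le> L2_set w {..<n} \<longrightarrow>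
     real (card {i\<in>{..<m}. \<bar>\<Sum>j<n. w j * \<omega> (i, j)\<bar> < 2 * \<delta>}) \<le> real m / 8)"

lemma measurable_card_small_rows [measurable]:
  "(\<lambda>\<omega>. real (card {i\<in>{..<m}. \<bar>\<Sum>j<n. w j * \<omega> (i, j)\<bar> < t})) \<in> borel_measurable (gaussian_array m n)"
proof -
  have *: "real (card {i\<in>{..<m}. \<bar>\<Sum>j<n. w j * \<omega> (i, j)\<bar> < t})
      = (\<Sum>i<m. if \<bar>\<Sum>j<n. w j * \<omega> (i, j)\<bar> < t then 1 else 0)" for \<omega> :: "nat \<times> nat \<Rightarrow> real"
    by (simp add: sum.If_cases Int_def)
  show ?thesis unfolding * by measurable
qed

lemma sets_net_spread: "{\<omega> \<in> space (gaussian_array m n). net_spread q m n \<delta> \<omega>} \<in> sets (gaussian_array m n)"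
proof -
  note finite_grid_net [measurable]
  show ?thesis unfolding net_spread_def by measurable
qed

text \<open>By 3 \<le> e^2 and 2 \<le> e the net has at most e^((q + 3) n) \<le> e^m points, and
  each of norm at least 1/2 fails with probability at most e^(-2m).\<close>

lemma prob_not_net_spread:
  assumes n: "real (q + 3) * real n \<le> real m" and \<delta>: "4 * \<delta> = exp (- 24)"
  shows "measure (gaussian_array m n) {\<omega> \<in> space (gaussian_array m n). \<not> net_spread q m n \<delta> \<omega>}
         \<le> exp (- real m)"
proof -
  interpret prob_space "gaussian_array m n" by (rule prob_space_gaussian_array)
  let ?M = "gaussian_array m n"
  let ?S = "{w \<in> grid_net q n. 1 / 2 \<le> L2_set w {..<n}}"
  let ?F = "\<lambda>w. {\<omega> \<in> space ?M.
    real m / 8 < real (card {i\<in>{..<m}. \<bar>\<Sum>j<n. w j * \<omega> (i, j)\<bar> < 2 * \<delta>})}"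
  have sets: "?F w \<in> sets ?M" for w by measurable
  have "finite ?S" using finite_grid_net by simp
  have "card ?S \<le> card (grid_net q n)" using finite_grid_net by (intro card_mono) auto
  then have "real (card ?S) \<le> (3 * 2 ^ (q + 1)) ^ n"
    using card_grid_net[of q n] by linarith
  also have "\<dots> \<le> (exp 2 * exp 1 ^ (q + 1)) ^ n"
    using exp_ge_add_one_self[of 1] exp_ge_add_one_self[of 2]
    by (intro power_mono mult_mono) auto
  also have "exp 2 * exp 1 ^ (q + 1) = exp (real (q + 3))"
    by (simp add: algebra_simps flip: exp_of_nat_mult exp_add)
  also have "exp (real (q + 3)) ^ n = exp (real (q + 3) * real n)"
    by (simp add: mult.commute flip: exp_of_nat_mult)
  also have "\<dots> \<le> exp (real m)" using n by simp
  finally have card_S: "real (card ?S) \<le> exp (real m)" .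
  have "prob {\<omega> \<in> space ?M. \<not> net_spread q m n \<delta> \<omega>}
      = prob (\<Union>w\<in>?S. ?F w)" by (rule arg_cong[where f = prob]) (auto simp: net_spread_def not_le)
  also have "\<dots> \<le> (\<Sum>w\<in>?S. prob (?F w))"
    by (intro finite_measure_subadditive_finite \<open>finite ?S\<close> image_subsetI sets)
  also have "\<dots> \<le> (\<Sum>w\<in>?S. exp (- 2 * real m))"
    by (intro sum_mono many_small_rows) (use \<delta> in auto)
  also have "\<dots> = real (card ?S) * exp (- 2 * real m)" by simp
  also have "\<dots> \<le> exp (real m) * exp (- 2 * real m)"
    by (intro mult_right_mono card_S) simp
  also have "\<dots> = exp (- real m)" by (simp flip: exp_add)
  finally show ?thesis .
qed

subsection \<open>The inequality on the two good events\<close>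

text \<open>With \<sigma> the signs of the row products on \<open>T\<close>, the left side is the
  inner product of \<open>u\<close> with A^T \<sigma>, to which Cauchy-Schwarz applies.\<close>

lemma rows_boundedD:
  assumes E: "rows_bounded m n \<omega>" and T: "T \<subseteq> {..<m}"
  shows "(\<Sum>i\<in>T. \<bar>\<Sum>j<n. u j * \<omega> (i, j)\<bar>) \<le> L2_set u {..<n} * sqrt (12 * real m * real (card T))"
proof -
  let ?Y = "\<lambda>i. \<Sum>j<n. u j * \<omega> (i, j)"
  define \<sigma> where "\<sigma> = (\<lambda>i\<in>{..<m}. if i \<in> T then sgn (?Y i) else 0)"
  have \<sigma>: "\<sigma> \<in> {..<m} \<rightarrow>\<^sub>E {-1, 0, 1}" by (auto simp: \<sigma>_def sgn_if)
  \<comment> \<open>Only an inequality, as a vanishing row product has sign 0.\<close>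
  have "(\<Sum>i<m. (\<sigma> i)\<^sup>2) \<le> (\<Sum>i<m. if i \<in> T then 1 else 0)"
    by (intro sum_mono) (auto simp: \<sigma>_def sgn_if)
  also have "\<dots> = real (card T)" using T by (simp add: sum.If_cases Int_absorb1)
  finally have card: "(\<Sum>i<m. (\<sigma> i)\<^sup>2) \<le> real (card T)" .
  have "(\<Sum>i\<in>T. \<bar>?Y i\<bar>) = (\<Sum>i\<in>T. \<sigma> i * ?Y i)"
    using T by (intro sum.cong) (auto simp: \<sigma>_def abs_sgn mult.commute)
  also have "\<dots> = (\<Sum>i<m. \<sigma> i * ?Y i)"
    using T by (intro sum.mono_neutral_left) (auto simp: \<sigma>_def)
  also have "\<dots> = (\<Sum>i<m. \<Sum>j<n. u j * (\<sigma> i * \<omega> (i, j)))"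
    by (simp add: sum_distrib_left mult_ac)
  also have "\<dots> = (\<Sum>j<n. u j * (\<Sum>i<m. \<sigma> i * \<omega> (i, j)))"
    by (subst sum.swap) (simp add: sum_distrib_left)
  also have "\<dots> \<le> (\<Sum>j<n. \<bar>u j\<bar> * \<bar>\<Sum>i<m. \<sigma> i * \<omega> (i, j)\<bar>)"
    by (intro sum_mono) (simp flip: abs_mult)
  also have "\<dots> \<le> L2_set u {..<n} * L2_set (\<lambda>j. \<Sum>i<m. \<sigma> i * \<omega> (i, j)) {..<n}"
    by (rule L2_set_mult_ineq)
  also have "\<dots> \<le> L2_set u {..<n} * sqrt (12 * real m * real (card T))"
  proof (rule mult_left_mono)
    have "(\<Sum>j<n. (\<Sum>i<m. \<sigma> i * \<omega> (i, j))\<^sup>2) \<le> 12 * real m * (\<Sum>i<m. (\<sigma> i)\<^sup>2)"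
      using E \<sigma> by (auto simp: rows_bounded_def)
    also have "\<dots> \<le> 12 * real m * real (card T)" using card by (intro mult_left_mono) auto
    finally show "L2_set (\<lambda>j. \<Sum>i<m. \<sigma> i * \<omega> (i, j)) {..<n} \<le> sqrt (12 * real m * real (card T))"
      unfolding L2_set_def by (rule real_sqrt_le_mono)
  qed simp
  finally show ?thesis .
qed

text \<open>Writing u = w + h with \<open>w\<close> in the net, a row that is small for
  \<open>u\<close> is either below 2 \<delta> for \<open>w\<close> or at least \<delta> for
  \<open>h\<close>; each kind accounts for at most m / 8 rows.\<close>

lemma card_small_rows_sphere:
  assumes E: "rows_bounded m n \<omega>" and N: "net_spread q m n \<delta> \<omega>"
    and \<delta>: "0 < \<delta>" "\<delta> \<le> 1" and q: "10 / \<delta> \<le> real q" and u: "L2_set u {..<n} = 1"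
  shows "real (card {i\<in>{..<m}. \<bar>\<Sum>j<n. u j * \<omega> (i, j)\<bar> < \<delta>}) \<le> real m / 4"
proof -
  \<comment> \<open>The choice of \<open>q\<close> gives |h| \<le> \<delta> / 10 \<le> 1 / 10, which
    both keeps |w| above 1/2 and makes \<open>B\<close> small.\<close>
  have "10 \<le> 10 / \<delta>" using \<delta> by (simp add: field_simps)
  with q have q10: "10 \<le> real q" by linarith
  have q_le: "1 / real q \<le> \<delta> / 10" using q q10 \<delta> by (simp add: field_simps)
  obtain w where w: "w \<in> grid_net q n" and dist: "L2_set (\<lambda>j. u j - w j) {..<n} \<le> 1 / real q"
    using grid_net_approx[OF u, of q] q10 by auto
  define h where "h = (\<lambda>j. u j - w j)"
  have h: "L2_set h {..<n} \<le> \<delta> / 10" using dist q_le by (simp add: h_def)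
  have "1 \<le> L2_set h {..<n} + L2_set w {..<n}"
    using L2_set_triangle_ineq[of h w "{..<n}"] u by (simp add: h_def)
  then have w_half: "1 / 2 \<le> L2_set w {..<n}" using h \<delta> by linarith
  define W where "W = {i\<in>{..<m}. \<bar>\<Sum>j<n. w j * \<omega> (i, j)\<bar> < 2 * \<delta>}"
  define B where "B = {i\<in>{..<m}. \<delta> \<le> \<bar>\<Sum>j<n. h j * \<omega> (i, j)\<bar>}"
  have W: "real (card W) \<le> real m / 8"
    using N w w_half by (auto simp: net_spread_def W_def)
  have B: "real (card B) \<le> real m / 8"
  proof (cases "card B = 0")
    case False
    then have b: "0 < real (card B)" by simp
    \<comment> \<open>With b = \<open>card B\<close>, the inequality b \<delta> \<le> (\<delta> /
      10) sqrt (12 m b) forces b \<le> 12 m / 100 \<le> m / 8.\<close>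
    have "real (card B) * \<delta> = (\<Sum>i\<in>B. \<delta>)" by simp
    also have "\<dots> \<le> (\<Sum>i\<in>B. \<bar>\<Sum>j<n. h j * \<omega> (i, j)\<bar>)"
      by (intro sum_mono) (simp add: B_def)
    also have "\<dots> \<le> L2_set h {..<n} * sqrt (12 * real m * real (card B))"
      by (rule rows_boundedD[OF E]) (auto simp: B_def)
    also have "\<dots> \<le> \<delta> / 10 * sqrt (12 * real m * real (card B))"
      using h by (intro mult_right_mono) auto
    finally have "10 * real (card B) \<le> sqrt (12 * real m * real (card B))"
      using \<delta> by (simp add: field_simps)
    then have "(10 * real (card B))\<^sup>2 \<le> (sqrt (12 * real m * real (card B)))\<^sup>2"
      by (intro power_mono) auto
    then have "(10 * real (card B))\<^sup>2 \<le> 12 * real m * real (card B)" by simp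
    then have "100 * real (card B) \<le> 12 * real m"
      using b by (simp add: power2_eq_square)
    then show ?thesis by simp
  qed simp
  have "{i\<in>{..<m}. \<bar>\<Sum>j<n. u j * \<omega> (i, j)\<bar> < \<delta>} \<subseteq> W \<union> B"
  proof
    fix i assume i: "i \<in> {i\<in>{..<m}. \<bar>\<Sum>j<n. u j * \<omega> (i, j)\<bar> < \<delta>}"
    have "(\<Sum>j<n. u j * \<omega> (i, j)) = (\<Sum>j<n. w j * \<omega> (i, j)) + (\<Sum>j<n. h j * \<omega> (i, j))"
      by (simp add: h_def algebra_simps flip: sum.distrib)
    with i show "i \<in> W \<union> B" by (auto simp: W_def B_def)
  qed
  then have "card {i\<in>{..<m}. \<bar>\<Sum>j<n. u j * \<omega> (i, j)\<bar> < \<delta>} \<le> card (W \<union> B)"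
    by (intro card_mono) (auto simp: W_def B_def)
  also have "\<dots> \<le> card W + card B" by (rule card_Un_le)
  finally show ?thesis using W B by linarith
qed

text \<open>Normalisation of \<open>u\<close> to the sphere. Using a lower bound \<open>r\<close> in
  place of the norm lets vectors of different length be tested at a common threshold.\<close>

lemma card_small_rows:
  assumes E: "rows_bounded m n \<omega>" and N: "net_spread q m n \<delta> \<omega>"
    and \<delta>: "0 < \<delta>" "\<delta> \<le> 1" and q: "10 / \<delta> \<le> real q"
    and r: "0 < r" "r \<le> L2_set u {..<n}"
  shows "real (card {i\<in>{..<m}. \<bar>\<Sum>j<n. u j * \<omega> (i, j)\<bar> < \<delta> * r}) \<le> real m / 4"
proof -
  let ?l = "L2_set u {..<n}"
  have l: "0 < ?l" using r by linarith
  have "L2_set (\<lambda>j. u j / ?l) {..<n} = 1"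
    using l L2_set_right_distrib[of "1 / ?l" u "{..<n}"] by simp
  from card_small_rows_sphere[OF E N \<delta> q this]
  have "real (card {i\<in>{..<m}. \<bar>\<Sum>j<n. u j / ?l * \<omega> (i, j)\<bar> < \<delta>}) \<le> real m / 4" .
  moreover have "card {i\<in>{..<m}. \<bar>\<Sum>j<n. u j * \<omega> (i, j)\<bar> < \<delta> * r}
      \<le> card {i\<in>{..<m}. \<bar>\<Sum>j<n. u j / ?l * \<omega> (i, j)\<bar> < \<delta>}"
  proof (rule card_mono, simp, safe)
    fix i assume "\<bar>\<Sum>j<n. u j * \<omega> (i, j)\<bar> < \<delta> * r"
    also have "\<dots> \<le> \<delta> * ?l" using r \<delta> by (intro mult_left_mono) auto
    finally have "\<bar>\<Sum>j<n. u j * \<omega> (i, j)\<bar> / ?l < \<delta>" using l by (simp add: field_simps)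
    also have "\<bar>\<Sum>j<n. u j * \<omega> (i, j)\<bar> / ?l = \<bar>(\<Sum>j<n. u j * \<omega> (i, j)) / ?l\<bar>"
      using l by simp
    also have "(\<Sum>j<n. u j * \<omega> (i, j)) / ?l = (\<Sum>j<n. u j / ?l * \<omega> (i, j))"
      by (simp add: sum_divide_distrib)
    finally show "\<bar>\<Sum>j<n. u j / ?l * \<omega> (i, j)\<bar> < \<delta>" .
  qed
  ultimately show ?thesis by linarith
qed

text \<open>On \<open>T\<close> the minimum is bounded by its \<open>u\<close> term, which sums to
  at most \<delta> |u| m / 8. Off \<open>T\<close> at least m / 4 rows have both products at least
  \<delta> |u|, which sums to at least \<delta> |u| m / 4; hence the factor 1/2.\<close>

lemma min_rows_bound:
  assumes E: "rows_bounded m n \<omega>" and N: "net_spread q m n \<delta> \<omega>"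
    and \<delta>: "0 < \<delta>" "\<delta> \<le> 1" and q: "10 / \<delta> \<le> real q"
    and T: "T \<subseteq> {..<m}" "real (card T) \<le> \<delta>\<^sup>2 / 1000 * real m"
    and uv: "L2_set u {..<n} \<le> L2_set v {..<n}"
  defines "a \<equiv> \<lambda>i. min \<bar>\<Sum>j<n. u j * \<omega> (i, j)\<bar> \<bar>\<Sum>j<n. v j * \<omega> (i, j)\<bar>"
  shows "(\<Sum>i\<in>T. a i) \<le> 1 / 2 * (\<Sum>i\<in>{..<m} - T. a i)"
proof -
  let ?l = "L2_set u {..<n}"
  have a0: "0 \<le> a i" for i by (simp add: a_def)
  have "(\<Sum>i\<in>T. a i) \<le> (\<Sum>i\<in>T. \<bar>\<Sum>j<n. u j * \<omega> (i, j)\<bar>)"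
    by (intro sum_mono) (simp add: a_def)
  also have "\<dots> \<le> ?l * sqrt (12 * real m * real (card T))"
    by (rule rows_boundedD[OF E T(1)])
  also have "\<dots> \<le> ?l * (\<delta> * real m / 8)"
  proof (rule mult_left_mono)
    \<comment> \<open>The constant 1000 is large enough for 12 / 1000 \<le> 1 / 64 = (1 /
      8)^2.\<close>
    have "12 * real m * real (card T) \<le> 12 * real m * (\<delta>\<^sup>2 / 1000 * real m)"
      using T(2) by (intro mult_left_mono) auto
    also have "\<dots> = 12 / 1000 * (\<delta> * real m)\<^sup>2" by (simp add: power2_eq_square)
    also have "\<dots> \<le> 1 / 64 * (\<delta> * real m)\<^sup>2" by (intro mult_right_mono) auto
    also have "\<dots> = (\<delta> * real m / 8)\<^sup>2" by (simp add: power2_eq_square)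
    finally show "sqrt (12 * real m * real (card T)) \<le> \<delta> * real m / 8"
      using \<delta> by (intro real_le_lsqrt) auto
  qed simp
  finally have upper: "(\<Sum>i\<in>T. a i) \<le> ?l * (\<delta> * real m / 8)" .
  show ?thesis
  proof (cases "?l = 0")
    case True
    then show ?thesis using upper sum_nonneg[of "{..<m} - T" a] a0 by simp
  next
    case False
    then have l: "0 < ?l" using L2_set_nonneg[of u "{..<n}"] by linarith
    \<comment> \<open>Both sets use the threshold \<delta> |u|; for \<open>v\<close> this is
      legitimate because \<open>uv\<close> bounds its norm below by |u|.\<close>
    define U V where "U = {i\<in>{..<m}. \<bar>\<Sum>j<n. u j * \<omega> (i, j)\<bar> < \<delta> * ?l}"
      and "V = {i\<in>{..<m}. \<bar>\<Sum>j<n. v j * \<omega> (i, j)\<bar> < \<delta> * ?l}"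
    have U: "real (card U) \<le> real m / 4"
      unfolding U_def by (rule card_small_rows[OF E N \<delta> q l order.refl])
    have V: "real (card V) \<le> real m / 4"
      unfolding V_def by (rule card_small_rows[OF E N \<delta> q l uv])
    define G where "G = {..<m} - (T \<union> U \<union> V)"
    have "card (T \<union> U \<union> V) \<le> card T + card U + card V"
      using card_Un_le[of "T \<union> U" V] card_Un_le[of T U] by linarith
    moreover have "m - card (T \<union> U \<union> V) \<le> card G"
      unfolding G_def using diff_card_le_card_Diff[of "T \<union> U \<union> V" "{..<m}"] T(1) finite_subset
      by (auto simp: U_def V_def)
    \<comment> \<open>\<open>T\<close>, \<open>U\<close> and \<open>V\<close> remove at most m / 4
      rows each, so m / 4 rows remain in \<open>G\<close>.\<close>
    moreover have "real (card T) \<le> real m / 4"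
    proof -
      have "\<delta>\<^sup>2 / 1000 \<le> 1 / 4" using power_le_one[of \<delta> 2] \<delta> by simp
      then have "\<delta>\<^sup>2 / 1000 * real m \<le> 1 / 4 * real m" by (rule mult_right_mono) simp
      with T(2) show ?thesis by linarith
    qed
    ultimately have "real m / 4 \<le> real (card G)" using U V by linarith
    then have "real m / 4 * (\<delta> * ?l) \<le> real (card G) * (\<delta> * ?l)"
      using \<delta> by (intro mult_right_mono) auto
    also have "\<dots> = (\<Sum>i\<in>G. \<delta> * ?l)" by simp
    also have "\<dots> \<le> (\<Sum>i\<in>G. a i)"
      by (intro sum_mono) (auto simp: G_def U_def V_def a_def)
    also have "\<dots> \<le> (\<Sum>i\<in>{..<m} - T. a i)"
      using a0 by (intro sum_mono2) (auto simp: G_def)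
    finally have "real m / 4 * (\<delta> * ?l) \<le> (\<Sum>i\<in>{..<m} - T. a i)" .
    then show ?thesis using upper by (simp add: algebra_simps)
  qed
qed

lemma abs_diff_abs_eq_min: "\<bar>\<bar>a\<bar> - \<bar>b\<bar>\<bar> = min \<bar>a - b\<bar> \<bar>a + b\<bar>" for a b :: real
  by (auto simp: min_def abs_if)

text \<open>The minimum is symmetric, so the shorter of x - y and x + y can take the first role in
  \<open>min_rows_bound\<close>.\<close>

lemma abs_diff_rows_bound:
  fixes x y :: "nat \<Rightarrow> real"
  assumes E: "rows_bounded m n \<omega>" and N: "net_spread q m n \<delta> \<omega>"
    and \<delta>: "0 < \<delta>" "\<delta> \<le> 1" and q: "10 / \<delta> \<le> real q"
    and T: "T \<subseteq> {..<m}" "real (card T) \<le> \<delta>\<^sup>2 / 1000 * real m"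
  defines "d \<equiv> \<lambda>i. \<bar>\<bar>\<Sum>j<n. x j * \<omega> (i, j)\<bar> - \<bar>\<Sum>j<n. y j * \<omega> (i, j)\<bar>\<bar>"
  shows "(\<Sum>i\<in>T. d i) \<le> 1 / 2 * (\<Sum>i\<in>{..<m} - T. d i)"
proof -
  define u v where "u = (\<lambda>j. x j - y j)" and "v = (\<lambda>j. x j + y j)"
  have d: "d i = min \<bar>\<Sum>j<n. u j * \<omega> (i, j)\<bar> \<bar>\<Sum>j<n. v j * \<omega> (i, j)\<bar>" for i
    by (simp add: d_def u_def v_def abs_diff_abs_eq_min algebra_simps sum.distrib sum_subtractf)
  have d': "d i = min \<bar>\<Sum>j<n. v j * \<omega> (i, j)\<bar> \<bar>\<Sum>j<n. u j * \<omega> (i, j)\<bar>" for i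
    unfolding d by (rule min.commute)
  show ?thesis
  proof (cases "L2_set u {..<n} \<le> L2_set v {..<n}")
    case True
    show ?thesis unfolding d by (rule min_rows_bound[OF E N \<delta> q T True])
  next
    case False
    then have "L2_set v {..<n} \<le> L2_set u {..<n}" by simp
    then show ?thesis unfolding d' by (rule min_rows_bound[OF E N \<delta> q T])
  qed
qed

subsection \<open>The absolute range event and its measurability\<close>

text \<open>Plain functions and explicit sums replace vectors and norms, which exposes measurability
  in \<omega> and continuity in \<open>x\<close> and \<open>y\<close>; only the values of
  \<open>x\<close> and \<open>y\<close> below \<open>n\<close> enter.\<close>

definition arp_ineq :: "nat \<Rightarrow> nat \<Rightarrow> (nat \<times> nat \<Rightarrow> real) \<Rightarrow> real \<Rightarrow> nat set \<Rightarrow>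
    (nat \<Rightarrow> real) \<Rightarrow> (nat \<Rightarrow> real) \<Rightarrow> bool" where
  "arp_ineq m n \<omega> \<psi> T x y \<longleftrightarrow>
     (\<Sum>i\<in>T. \<bar>\<bar>\<Sum>j<n. x j * \<omega> (i, j)\<bar> - \<bar>\<Sum>j<n. y j * \<omega> (i, j)\<bar>\<bar>)
     \<le> \<psi> * (\<Sum>i\<in>{..<m} - T. \<bar>\<bar>\<Sum>j<n. x j * \<omega> (i, j)\<bar> - \<bar>\<Sum>j<n. y j * \<omega> (i, j)\<bar>\<bar>)"

text \<open>The event quantifies over uncountably many \<open>x\<close> and \<open>y\<close>; for its measurability these are
  reduced to rational vectors.\<close>

lemma rational_approx:
  fixes x :: "nat \<Rightarrow> real"
  obtains f where "\<And>k. f k \<in> {..<n} \<rightarrow>\<^sub>E \<rat>" "\<And>j. j < n \<Longrightarrow> (\<lambda>k. f k j) \<longlonglongrightarrow> x j"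
proof -
  have "\<exists>s. (\<forall>k. s k \<in> \<rat>) \<and> s \<longlonglongrightarrow> r" for r :: real
    using Rats_closure_real closure_sequential[of r \<rat>] by auto
  then obtain s where s: "s r k \<in> \<rat>" "s r \<longlonglongrightarrow> r" for r :: real and k
    by metis
  show ?thesis
    by (rule that[of "\<lambda>k. \<lambda>j\<in>{..<n}. s (x j) k"]) (use s in auto)
qed

text \<open>Both sides are continuous in \<open>x\<close> and \<open>y\<close>, so the inequality
  passes to limits of rational vectors.\<close>

lemma arp_ineq_rational:
  assumes "T \<subseteq> {..<m}" and Q: "\<And>x y. x \<in> {..<n} \<rightarrow>\<^sub>E \<rat> \<Longrightarrow> y \<in> {..<n} \<rightarrow>\<^sub>E \<rat> \<Longrightarrow> arp_ineq m n \<omega> \<psi> T x y"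
  shows "arp_ineq m n \<omega> \<psi> T x y"
proof -
  obtain f where f: "\<And>k. f k \<in> {..<n} \<rightarrow>\<^sub>E \<rat>" "\<And>j. j < n \<Longrightarrow> (\<lambda>k. f k j) \<longlonglongrightarrow> x j"
    using rational_approx by blast
  obtain g where g: "\<And>k. g k \<in> {..<n} \<rightarrow>\<^sub>E \<rat>" "\<And>j. j < n \<Longrightarrow> (\<lambda>k. g k j) \<longlonglongrightarrow> y j"
    using rational_approx by blast
  have lim: "(\<lambda>k. \<Sum>i\<in>S. \<bar>\<bar>\<Sum>j<n. f k j * \<omega> (i, j)\<bar> - \<bar>\<Sum>j<n. g k j * \<omega> (i, j)\<bar>\<bar>)
      \<longlonglongrightarrow> (\<Sum>i\<in>S. \<bar>\<bar>\<Sum>j<n. x j * \<omega> (i, j)\<bar> - \<bar>\<Sum>j<n. y j * \<omega> (i, j)\<bar>\<bar>)" for S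
    by (intro tendsto_intros f(2) g(2)) auto
  show ?thesis
    unfolding arp_ineq_def
    using Q[OF f(1) g(1)] by (intro LIMSEQ_le[OF lim tendsto_mult_left[OF lim]]) (simp add: arp_ineq_def)
qed

text \<open>Restricting to rational \<open>x\<close> and \<open>y\<close> turns the event into a
  countable intersection of measurable ones.\<close>

lemma sets_arp_event:
  "{\<omega> \<in> space (gaussian_array m n). \<forall>x y T. T \<subseteq> {..<m} \<longrightarrow> real (card T) \<le> L \<longrightarrow> arp_ineq m n \<omega> \<psi> T x y}
     \<in> sets (gaussian_array m n)" (is "?E \<in> _")
proof -
  let ?M = "gaussian_array m n"
  let ?Q = "{..<n} \<rightarrow>\<^sub>E (\<rat> :: real set)"
  let ?S = "{T. T \<subseteq> {..<m} \<and> real (card T) \<le> L}"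
  have "countable ?Q" by (intro countable_PiE countable_rat) auto
  have "finite ?S" by (rule finite_subset[of _ "Pow {..<m}"]) auto
  have meas: "{\<omega> \<in> space ?M. arp_ineq m n \<omega> \<psi> T x y} \<in> sets ?M" if "T \<in> ?S" for T x y
  proof -
    have [measurable]: "finite T" "\<And>i. i \<in> T \<Longrightarrow> i < m" using that finite_subset by auto
    show ?thesis unfolding arp_ineq_def by measurable
  qed
  have "?E = {\<omega> \<in> space ?M. \<forall>T\<in>?S. \<forall>x\<in>?Q. \<forall>y\<in>?Q. arp_ineq m n \<omega> \<psi> T x y}"
    using arp_ineq_rational[where \<psi> = \<psi>] by blast
  also have "\<dots> \<in> sets ?M"
    by (intro sets.sets_Collect_countable_All' countable_finite meas
         \<open>countable ?Q\<close> \<open>finite ?S\<close>)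
  finally show ?thesis .
qed

lemma l1_norm_restrict_abs_diff:
  assumes "x \<in> carrier_vec n" "y \<in> carrier_vec n" "T \<subseteq> {..<m}"
  shows "l1_norm (restrict_vec (abs_vec (mat m n \<omega> *\<^sub>v x) - abs_vec (mat m n \<omega> *\<^sub>v y)) T)
    = (\<Sum>i\<in>T. \<bar>\<bar>\<Sum>j<n. x $ j * \<omega> (i, j)\<bar> - \<bar>\<Sum>j<n. y $ j * \<omega> (i, j)\<bar>\<bar>)"
proof -
  have row: "scalar_prod (vec n (\<lambda>j. \<omega> (i, j))) z = (\<Sum>j<n. z $ j * \<omega> (i, j))" if "z \<in> carrier_vec n" for z i
    using that by (auto simp: scalar_prod_def lessThan_atLeast0 intro!: sum.cong)
  have "l1_norm (restrict_vec (abs_vec (mat m n \<omega> *\<^sub>v x) - abs_vec (mat m n \<omega> *\<^sub>v y)) T)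
    = (\<Sum>i<m. if i \<in> T then \<bar>\<bar>\<Sum>j<n. x $ j * \<omega> (i, j)\<bar> - \<bar>\<Sum>j<n. y $ j * \<omega> (i, j)\<bar>\<bar> else 0)"
    unfolding l1_norm_def restrict_vec_def abs_vec_def
    using assms by (auto intro!: sum.cong simp: row)
  also have "\<dots> = (\<Sum>i\<in>T. \<bar>\<bar>\<Sum>j<n. x $ j * \<omega> (i, j)\<bar> - \<bar>\<Sum>j<n. y $ j * \<omega> (i, j)\<bar>\<bar>)"
    using assms(3) by (simp add: sum.If_cases Int_absorb1)
  finally show ?thesis .
qed

lemma arp_event_eq:
  "(\<forall>x \<in> carrier_vec n. \<forall>y \<in> carrier_vec n. \<forall>T \<subseteq> {..<m}. real (card T) \<le> L \<longrightarrow>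
      l1_norm (restrict_vec (abs_vec (mat m n \<omega> *\<^sub>v x) - abs_vec (mat m n \<omega> *\<^sub>v y)) T)
      \<le> \<psi> * l1_norm (restrict_vec (abs_vec (mat m n \<omega> *\<^sub>v x) - abs_vec (mat m n \<omega> *\<^sub>v y)) ({..<m} - T)))
   \<longleftrightarrow> (\<forall>x y T. T \<subseteq> {..<m} \<longrightarrow> real (card T) \<le> L \<longrightarrow> arp_ineq m n \<omega> \<psi> T x y)"
  (is "?l \<longleftrightarrow> ?r")
proof
  assume l: ?l
  show ?r
  proof (intro allI impI)
    fix x y T assume T: "T \<subseteq> {..<m}" "real (card T) \<le> L"
    \<comment> \<open>\<open>vec n x\<close> cuts the function down to a vector with the same first
      \<open>n\<close> entries.\<close>
    have "arp_ineq m n \<omega> \<psi> T (\<lambda>j. vec n x $ j) (\<lambda>j. vec n y $ j)"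
      using l[rule_format, OF vec_carrier vec_carrier T, of x y] T
      by (simp only: arp_ineq_def l1_norm_restrict_abs_diff[OF vec_carrier vec_carrier] Diff_subset)
    then show "arp_ineq m n \<omega> \<psi> T x y" by (simp add: arp_ineq_def)
  qed
next
  assume ?r
  then show ?l by (auto simp: arp_ineq_def l1_norm_restrict_abs_diff)
qed

lemma absolute_range_property_1_mat:
  assumes "0 < \<psi>" "\<psi> < 1"
  shows "absolute_range_property 1 L \<psi> (mat m n \<omega>) \<longleftrightarrow>
    (\<forall>x y T. T \<subseteq> {..<m} \<longrightarrow> real (card T) \<le> L \<longrightarrow> arp_ineq m n \<omega> \<psi> T x y)"
proof -
  have "pow_vec z 1 = z" for z by (auto simp: pow_vec_def)
  then show ?thesis
    using assms unfolding arp_event_eq[symmetric] by (simp add: absolute_range_property_def)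
qed

section \<open>Probability of the event and choice of the constants\<close>

text \<open>Outside two bad events the inequality holds deterministically, and each of them has
  probability at most e^(-m).\<close>

lemma arp_event_prob:
  assumes \<delta>: "4 * \<delta> = exp (- 24)" and q: "10 / \<delta> \<le> real q"
    and mn: "real (q + 3) * real n \<le> real m"
  shows "1 - 2 * exp (- real m) \<le> measure (gaussian_array m n)
    {\<omega> \<in> space (gaussian_array m n). \<forall>x y T. T \<subseteq> {..<m} \<longrightarrow> real (card T) \<le> \<delta>\<^sup>2 / 1000 * real m \<longrightarrow>
       arp_ineq m n \<omega> (1 / 2) T x y}" (is "_ \<le> measure ?M ?E")
proof -
  interpret prob_space "gaussian_array m n" by (rule prob_space_gaussian_array)
  have "0 < \<delta>" using \<delta> exp_gt_zero[of "-24 :: real"] by linarith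
  have "\<delta> \<le> 1" using \<delta> one_le_exp_iff[of "-24 :: real"] by linarith
  have "1 * real n \<le> real (q + 3) * real n" by (intro mult_right_mono) auto
  with mn have "n \<le> m" by linarith
  have not_good: "space ?M - ?E \<subseteq> {\<omega> \<in> space ?M. \<not> rows_bounded m n \<omega>} \<union> {\<omega> \<in> space ?M. \<not> net_spread q m n \<delta> \<omega>}"
    unfolding arp_ineq_def using abs_diff_rows_bound[OF _ _ \<open>0 < \<delta>\<close> \<open>\<delta> \<le> 1\<close> q] by blast
  have meas: "{\<omega> \<in> space ?M. \<not> rows_bounded m n \<omega>} \<in> events" "{\<omega> \<in> space ?M. \<not> net_spread q m n \<delta> \<omega>} \<in> events"
    by (intro sets.sets_Collect_neg sets_rows_bounded sets_net_spread)+
  have "1 - prob ?E = prob (space ?M - ?E)" by (simp only: prob_compl sets_arp_event)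
  also have "\<dots> \<le> prob ({\<omega> \<in> space ?M. \<not> rows_bounded m n \<omega>} \<union> {\<omega> \<in> space ?M. \<not> net_spread q m n \<delta> \<omega>})"
    by (rule finite_measure_mono[OF not_good sets.Un[OF meas]])
  also have "\<dots> \<le> prob {\<omega> \<in> space ?M. \<not> rows_bounded m n \<omega>} + prob {\<omega> \<in> space ?M. \<not> net_spread q m n \<delta> \<omega>}"
    by (rule measure_Un_le[OF meas])
  also have "\<dots> \<le> exp (- real m) + exp (- real m)"
    by (intro add_mono prob_not_rows_bounded prob_not_net_spread \<open>n \<le> m\<close> mn \<delta>)
  finally show ?thesis by simp
qed

theorem lemma4p8:
  shows "\<exists>c\<^sub>0 c\<^sub>1 C s \<psi> :: real.
    0 < c\<^sub>0 \<and> 0 < c\<^sub>1 \<and> 0 < C \<and> 0 < s \<and> s < 1 \<and> 0 < \<psi> \<and> \<psi> < 1 \<and>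
    (\<forall>m n :: nat. real m > c\<^sub>0 * real n \<longrightarrow>
       measure (gaussian_array m n)
         {\<omega> \<in> space (gaussian_array m n). let A = mat m n \<omega> in
            \<forall>x \<in> carrier_vec n. \<forall>y \<in> carrier_vec n. \<forall>T \<subseteq> {..<m}.
              real (card T) \<le> s * real m \<longrightarrow>
              l1_norm (restrict_vec (abs_vec (A *\<^sub>v x) - abs_vec (A *\<^sub>v y)) T)
              \<le> \<psi> * l1_norm (restrict_vec (abs_vec (A *\<^sub>v x) - abs_vec (A *\<^sub>v y)) ({..<m} - T))}
       \<ge> 1 - C * exp (- c\<^sub>1 * real m)) \<and>
    (\<forall>\<epsilon> > 0. \<exists>m\<^sub>0 :: nat. \<forall>m \<ge> m\<^sub>0. \<forall>n :: nat. real m > c\<^sub>0 * real n \<longrightarrow>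
       measure (gaussian_array m n)
         {\<omega> \<in> space (gaussian_array m n).
            absolute_range_property 1 (s * real m) \<psi> (mat m n \<omega>)}
       \<ge> 1 - \<epsilon>)"
proof -
  \<comment> \<open>Makes twice the threshold 2 \<delta> of \<open>net_spread\<close> equal to
    e^(-24), as \<open>many_small_rows\<close> requires.\<close>
  define \<delta> :: real where "\<delta> = exp (- 24) / 4"
  have \<delta>: "4 * \<delta> = exp (- 24)" by (simp add: \<delta>_def)
  have "0 < \<delta>" by (simp add: \<delta>_def)
  have "\<delta> \<le> 1" using \<delta> one_le_exp_iff[of "-24 :: real"] by linarith
  \<comment> \<open>\<open>q\<close> depends on \<delta> alone, so \<open>c\<^sub>0 = q + 3\<close>
    is a universal constant.\<close>
  obtain q :: nat where q: "10 / \<delta> \<le> real q" using real_arch_simple by blast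
  have bound: "1 - 2 * exp (- real m) \<le> measure (gaussian_array m n)
    {\<omega> \<in> space (gaussian_array m n). \<forall>x y T. T \<subseteq> {..<m} \<longrightarrow> real (card T) \<le> \<delta>\<^sup>2 / 1000 * real m \<longrightarrow>
       arp_ineq m n \<omega> (1 / 2) T x y}" if "real (q + 3) * real n < real m" for m n
    using that by (intro arp_event_prob[OF \<delta> q]) simp
  \<comment> \<open>For the high-probability claim; the threshold \<open>m\<^sub>0\<close> depends
    only on \<epsilon>, not on the number of columns.\<close>
  have tail: "\<exists>m\<^sub>0 :: nat. \<forall>m\<ge>m\<^sub>0. 2 * exp (- real m) \<le> \<epsilon>" if "0 < \<epsilon>" for \<epsilon> :: real
  proof -
    have "(\<lambda>m. 2 * exp (- real m)) \<longlonglongrightarrow> 0" by real_asymp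
    then have "\<forall>\<^sub>F m in sequentially. 2 * exp (- real m) < \<epsilon>"
      using that by (rule order_tendstoD)
    then show ?thesis by (auto simp: eventually_sequentially intro: less_imp_le)
  qed
  have s: "0 < \<delta>\<^sup>2 / 1000" "\<delta>\<^sup>2 / 1000 < 1"
    using \<open>0 < \<delta>\<close> \<open>\<delta> \<le> 1\<close> power_le_one[of \<delta> 2] by auto
  let ?E = "\<lambda>m n. {\<omega> \<in> space (gaussian_array m n).
    \<forall>x y T. T \<subseteq> {..<m} \<longrightarrow> real (card T) \<le> \<delta>\<^sup>2 / 1000 * real m \<longrightarrow> arp_ineq m n \<omega> (1 / 2) T x y}"
  \<comment> \<open>The factor \<open>- 1\<close> is written out to match \<open>- c\<^sub>1\<close>
    at the witness 1. Both events of the claim are rewritten to \<open>?E\<close>, with s =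
    \<delta>^2 / 1000.\<close>
  have "(\<forall>m n :: nat. real (q + 3) * real n < real m \<longrightarrow>
      1 - 2 * exp (- 1 * real m) \<le> measure (gaussian_array m n) (?E m n)) \<and>
    (\<forall>\<epsilon>>0. \<exists>m\<^sub>0 :: nat. \<forall>m\<ge>m\<^sub>0. \<forall>n :: nat. real (q + 3) * real n < real m \<longrightarrow>
      1 - \<epsilon> \<le> measure (gaussian_array m n) (?E m n))"
  proof (intro conjI allI impI)
    fix m n :: nat assume "real (q + 3) * real n < real m"
    then show "1 - 2 * exp (- 1 * real m) \<le> measure (gaussian_array m n) (?E m n)"
      using bound by simp
  next
    fix \<epsilon> :: real assume "0 < \<epsilon>"
    then obtain m\<^sub>0 :: nat where m\<^sub>0: "\<And>m. m \<ge> m\<^sub>0 \<Longrightarrow> 2 * exp (- real m) \<le> \<epsilon>" using tail by blast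
    have "1 - \<epsilon> \<le> measure (gaussian_array m n) (?E m n)"
      if "m\<^sub>0 \<le> m" "real (q + 3) * real n < real m" for m n
      using bound[OF that(2)] m\<^sub>0[OF that(1)] by linarith
    then show "\<exists>m\<^sub>0 :: nat. \<forall>m\<ge>m\<^sub>0. \<forall>n :: nat. real (q + 3) * real n < real m \<longrightarrow>
        1 - \<epsilon> \<le> measure (gaussian_array m n) (?E m n)"
      by blast
  qed
  moreover have "0 < real (q + 3)" "0 < (1 :: real)" "0 < (2 :: real)" "0 < (1 / 2 :: real)" "1 / 2 < (1 :: real)"
    by simp_all
  moreover have "absolute_range_property 1 L (1 / 2) (mat m n \<omega>) \<longleftrightarrow>
      (\<forall>x y T. T \<subseteq> {..<m} \<longrightarrow> real (card T) \<le> L \<longrightarrow> arp_ineq m n \<omega> (1 / 2) T x y)" for m n L \<omega>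
    by (rule absolute_range_property_1_mat) auto
  ultimately show ?thesis
    unfolding Let_def arp_event_eq
    by (intro exI[of _ "real (q + 3)"] exI[of _ 1] exI[of _ 2] exI[of _ "\<delta>\<^sup>2 / 1000"] exI[of _ "1 / 2"])
       (simp only: s simp_thms)
qed

end
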